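(* Let $g$ satisfy the standing assumptions, let $\lambda>0$, $F(X)=g(X)+\lambda\,\mathrm{rank}(X)$ on $\mathbb{R}^{n\times k}$, and let the step size $s>0$ satisfy $s\le\min\{\frac{2\lambda}{G^2},\frac1L\}$. The sequences $\{Z^t\}_{t=1}^\infty$ and $\{X^t\}_{t=1}^\infty$ generated by the monotone accelerated proximal gradient descent with support projection (defined in the context) satisfy $$\mathrm{supp}(\sigma(Z^{t+1}))\subseteq\mathrm{supp}(\sigma(Z^t)),\qquad \mathrm{supp}(\sigma(X^{t+1}))\subseteq\mathrm{supp}(\sigma(X^t)),\qquad t\ge1.$$
   Context: Standing assumptions: $g:\mathbb{R}^{n\times k}\to\mathbb{R}$ is convex and differentiable; the largest singular value of its gradient is bounded, $\sigma_{\max}(\nabla g(X))\le G$ for all $X$; and $\nabla g$ is $L$-Lipschitz, $\|\nabla g(X_1)-\nabla g(X_2)\|_F\le L\|X_1-X_2\|_F$ for all $X_1,X_2$ ($G,L>0$, $\|\cdot\|_F$ the Frobenius norm). Notation: $\sigma(X)$ is the vector of the $\min(n,k)$ singular values of $X$ in non-increasing order; $\mathrm{supp}(v)$ is the set of indices of nonzero entries of a vector $v$. Superscripts on matrices and on $\alpha$ denote the iteration, except that $(\alpha^t)^2$ is the square of $\alpha^t$. Singular value hard thresholding: for $\theta\ge0$ and a singular value decomposition $Q=U\Sigma V^T$, $T_\theta(Q)=U\Sigma_\theta V^T$, where $\Sigma_\theta(i,i)=0$ if $|\Sigma(i,i)|\le\theta$ and $\Sigma_\theta(i,i)=\Sigma(i,i)$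 otherwise. Support projection: for a set of indices $I$ and a matrix $T$ with singular value decomposition $T=A\Sigma B^T$ (singular values in non-increasing order), $P_I(T)=A\Sigma_{\mathrm{projected}}B^T$, where $\Sigma_{\mathrm{projected}}(i,i)=\Sigma(i,i)$ if $i\in I$ and $0$ otherwise. Algorithm (monotone accelerated proximal gradient descent with support projection): given $X^0$ and an initial real parameter $\alpha^0$, set $Z^1=X^1=X^0$ and $\alpha^{t+1}=\frac{\sqrt{1+4(\alpha^t)^2}+1}{2}$ for $t\ge0$. For $t=1,2,\dots$: $$U^t=X^t+\frac{\alpha^{t-1}-1}{\alpha^t}(X^t-X^{t-1})+\frac{\alpha^t-1}{\alpha^t}(Z^t-X^t),\quad V^t=P_{\mathrm{supp}(\sigma(Z^t))}(U^t),$$ $$Z^{t+1}=T_{\sqrt{2\lambda s}}\big(V^t-s\nabla g(V^t)\big),\quad X^{t+1}=\begin{cases}Z^{t+1}&\text{if }F(Z^{t+1})\le F(X^t),\\ X^t&\text{otherwise.}\end{cases}$$ *)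

theory Defs
  imports "HOL-Analysis.Analysis"
begin

text \<open>
  An n-by-k real matrix has type \<open>real ^ 'k ^ 'n\<close>. On this type \<open>norm\<close> and the inner product
  are the Frobenius norm and the Frobenius inner product. Vectors of singular values are lists of
  length min(n,k), with positions counted from 0.

  The n-by-k matrix with diagonal \<open>s\<close> needs row and column indices to be matched with positions
  0, 1, 2, ...; this is done by the fixed enumeration \<open>to_nat_on UNIV\<close> of a finite type (a bijection
  onto \<open>{..<CARD('a)}\<close>). Which enumeration is used is irrelevant: another one only permutes the
  columns of the two orthogonal factors of a decomposition.
\<close>

definition rect_diag :: "real list \<Rightarrow> real ^ 'k ^ 'n" where
  "rect_diag s = (\<chi> i j. let p = to_nat_on (UNIV :: 'n set) i; q = to_nat_on (UNIV :: 'k set) j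
                          in if p = q \<and> p < length s then s ! p else 0)"

definition is_svd ::
  "real ^ 'k ^ 'n \<Rightarrow> real ^ 'n ^ 'n \<Rightarrow> real list \<Rightarrow> real ^ 'k ^ 'k \<Rightarrow> bool" where
  "is_svd Q A s B \<longleftrightarrow>
     orthogonal_matrix A \<and> orthogonal_matrix B \<and>
     length s = min CARD('n) CARD('k) \<and> (\<forall>x \<in> set s. 0 \<le> x) \<and>
     Q = A ** rect_diag s ** transpose B"

definition is_ordered_svd ::
  "real ^ 'k ^ 'n \<Rightarrow> real ^ 'n ^ 'n \<Rightarrow> real list \<Rightarrow> real ^ 'k ^ 'k \<Rightarrow> bool" where
  "is_ordered_svd Q A s B \<longleftrightarrow> is_svd Q A s B \<and> sorted_wrt (\<ge>) s"

text \<open>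
  Every matrix has an ordered singular value decomposition, and its list \<open>s\<close> is unique
  (the two orthogonal factors are not).
\<close>

definition singular_values :: "real ^ 'k ^ 'n \<Rightarrow> real list" where
  "singular_values Q = (THE s. \<exists>A B. is_ordered_svd Q A s B)"

definition sigma_max :: "real ^ 'k ^ 'n \<Rightarrow> real" where
  "sigma_max Q = Max (set (singular_values Q))"

definition supp :: "real list \<Rightarrow> nat set" where
  "supp v = {i. i < length v \<and> v ! i \<noteq> 0}"

text \<open>
  Thresholding and support projection are relations between the input matrix and the result,
  the result being computed from some decomposition of the input. For thresholding the result does
  not depend on the decomposition. For the support projection it may, when \<open>I\<close> contains only some
  of the positions of a repeated singular value; any choice is then allowed.
\<close>

definition is_hard_threshold :: "real \<Rightarrow> real ^ 'k ^ 'n \<Rightarrow> real ^ 'k ^ 'n \<Rightarrow> bool" where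
  "is_hard_threshold \<theta> Q R \<longleftrightarrow>
     (\<exists>A s B. is_svd Q A s B \<and>
        R = A ** rect_diag (map (\<lambda>x. if \<bar>x\<bar> \<le> \<theta> then 0 else x) s) ** transpose B)"

definition is_support_projection :: "nat set \<Rightarrow> real ^ 'k ^ 'n \<Rightarrow> real ^ 'k ^ 'n \<Rightarrow> bool" where
  "is_support_projection I T P \<longleftrightarrow>
     (\<exists>A s B. is_ordered_svd T A s B \<and>
        P = A ** rect_diag (map (\<lambda>i. if i \<in> I then s ! i else 0) [0..<length s]) ** transpose B)"

definition rank_objective ::
  "(real ^ 'k ^ 'n \<Rightarrow> real) \<Rightarrow> real \<Rightarrow> real ^ 'k ^ 'n \<Rightarrow> real" where
  "rank_objective g lam X = g X + lam * real (rank X)"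

text \<open>
  A run of the algorithm; \<open>dg\<close> is the gradient of \<open>g\<close>. The starting point \<open>X 0\<close> and the
  initial parameter \<open>\<alpha> 0\<close> are arbitrary; \<open>Z 0\<close>, \<open>U 0\<close> and \<open>V 0\<close> play no role.
\<close>

definition apg_support_run ::
  "(real ^ 'k ^ 'n \<Rightarrow> real) \<Rightarrow> (real ^ 'k ^ 'n \<Rightarrow> real ^ 'k ^ 'n) \<Rightarrow> real \<Rightarrow> real \<Rightarrow>
   (nat \<Rightarrow> real) \<Rightarrow> (nat \<Rightarrow> real ^ 'k ^ 'n) \<Rightarrow> (nat \<Rightarrow> real ^ 'k ^ 'n) \<Rightarrow>
   (nat \<Rightarrow> real ^ 'k ^ 'n) \<Rightarrow> (nat \<Rightarrow> real ^ 'k ^ 'n) \<Rightarrow> bool" where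
  "apg_support_run g dg lam s \<alpha> X Z U V \<longleftrightarrow>
     X 1 = X 0 \<and> Z 1 = X 0 \<and>
     (\<forall>t. \<alpha> (t + 1) = (sqrt (1 + 4 * (\<alpha> t)\<^sup>2) + 1) / 2) \<and>
     (\<forall>t\<ge>1.
        U t = X t + ((\<alpha> (t - 1) - 1) / \<alpha> t) *\<^sub>R (X t - X (t - 1))
                  + ((\<alpha> t - 1) / \<alpha> t) *\<^sub>R (Z t - X t) \<and>
        is_support_projection (supp (singular_values (Z t))) (U t) (V t) \<and>
        is_hard_threshold (sqrt (2 * lam * s)) (V t - s *\<^sub>R dg (V t)) (Z (t + 1)) \<and>
        X (t + 1) = (if rank_objective g lam (Z (t + 1)) \<le> rank_objective g lam (X t)
                     then Z (t + 1) else X t))"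

end

theory Submission
  imports Defs
begin

text \<open>
  The support of a decreasing list of singular values is an initial segment, so the claim is that
  the number of nonzero singular values, that is, the rank, does not increase.

  For \<open>Z\<close> this is an inequality of Weyl type. The projected matrix \<open>V t\<close> has rank at most that of
  \<open>Z t\<close>, so its kernel \<open>N\<close> has at most that codimension. On \<open>N\<close> the gradient step
  \<open>V t - s *\<^sub>R dg (V t)\<close> reduces to \<open>- s *\<^sub>R dg (V t)\<close>, which stretches vectors by at most
  \<open>s * G \<le> sqrt (2 * lam * s)\<close>; this inequality is the step size condition \<open>s \<le> 2 * lam / G\<^sup>2\<close>.
  A matrix with this property has at most \<open>codim N\<close> singular values above the threshold
  (\<open>svd_count_bound\<close>), and only those survive in \<open>Z (t + 1)\<close> (\<open>support_step\<close>). For \<open>X\<close>, each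
  \<open>X t\<close> is some \<open>Z j\<close> with \<open>j \<le> t\<close>, whose rank is at least that of \<open>Z (t + 1)\<close>.

  Singular values are given by a definite description, so existence and uniqueness of the ordered
  decomposition have to be established. Existence (\<open>is_ordered_svd_exists\<close>) follows from the
  spectral theorem for self-adjoint maps (\<open>self_adjoint_sorted_eigenbasis\<close>). Uniqueness
  (\<open>ordered_svd_unique\<close>) follows from the same count of singular values above a level that
  drives the main estimate.
\<close>

section \<open>Orthonormal families\<close>

text \<open>
  Families indexed by an initial segment of the naturals, rather than sets of vectors, keep the
  order in which singular vectors are paired with the entries of a list of singular values.
\<close>

definition orthonormal_upto :: "nat \<Rightarrow> (nat \<Rightarrow> 'a::real_inner) \<Rightarrow> bool" where
  "orthonormal_upto m v \<longleftrightarrow> (\<forall>i<m. \<forall>j<m. v i \<bullet> v j = (if i = j then 1 else 0))"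

lemma orthonormal_upto_dim_span:
  fixes v :: "nat \<Rightarrow> 'a::euclidean_space"
  assumes v: "orthonormal_upto m v" and J: "J \<subseteq> {..<m}"
  shows "dim (span (v ` J)) = card J"
proof -
  have inner: "v i \<bullet> v j = (if i = j then 1 else 0)" if "i \<in> J" "j \<in> J" for i j
    using v J that by (auto simp: orthonormal_upto_def subset_iff)
  have inj: "inj_on v J"
    by (rule inj_onI) (metis inner zero_neq_one)
  have "0 \<notin> v ` J"
    using inner by (metis image_iff inner_zero_left zero_neq_one)
  moreover have "pairwise orthogonal (v ` J)"
    by (auto simp: pairwise_def orthogonal_def inner)
  ultimately have "independent (v ` J)"
    by (rule pairwise_orthogonal_independent[rotated])
  then show ?thesis
    by (simp add: dim_eq_card_independent card_image inj)
qed

lemma inner_zero_outside_span: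
  assumes v: "orthonormal_upto m v" and J: "J \<subseteq> {..<m}" and x: "x \<in> span (v ` J)"
    and j: "j < m" "j \<notin> J"
  shows "v j \<bullet> x = 0"
proof -
  have "orthogonal (v j) x"
    using x
  proof (rule orthogonal_to_span)
    fix y assume "y \<in> v ` J"
    then show "orthogonal (v j) y"
      using v J j by (auto simp: orthonormal_upto_def orthogonal_def subset_iff)
  qed
  then show ?thesis by (simp add: orthogonal_def)
qed

lemma orthonormal_upto_le_DIM:
  fixes v :: "nat \<Rightarrow> 'a::euclidean_space"
  assumes "orthonormal_upto m v"
  shows "m \<le> DIM('a)"
  using orthonormal_upto_dim_span[OF assms order_refl] dim_subset_UNIV[of "span (v ` {..<m})"]
  by simp

lemma orthonormal_upto_extend:
  fixes u :: "nat \<Rightarrow> 'a::euclidean_space"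
  assumes u: "orthonormal_upto r u" and "r \<le> m" and "m \<le> DIM('a)"
  shows "\<exists>w. orthonormal_upto m w \<and> (\<forall>i<r. w i = u i)"
  using \<open>r \<le> m\<close> \<open>m \<le> DIM('a)\<close>
proof (induction m rule: dec_induct)
  case base
  then show ?case using u by auto
next
  case (step m)
  then obtain w where w: "orthonormal_upto m w" "\<forall>i<r. w i = u i"
    by auto
  have "dim (span (w ` {..<m})) < DIM('a)"
    using orthonormal_upto_dim_span[OF w(1) order_refl] step.prems by simp
  then obtain x where x: "x \<noteq> 0" "\<And>y. y \<in> span (w ` {..<m}) \<Longrightarrow> orthogonal x y"
    using orthogonal_to_subspace_exists[of "w ` {..<m}"] by auto
  have x_orth: "x \<bullet> w i = 0" if "i < m" for i
    using x(2)[of "w i"] that by (auto simp: orthogonal_def intro: span_base)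
  have x_unit: "(x /\<^sub>R norm x) \<bullet> (x /\<^sub>R norm x) = 1"
    using x(1) by (metis norm_eq_1 norm_sgn sgn_div_norm)
  have "orthonormal_upto (Suc m) (w(m := x /\<^sub>R norm x))"
    using w(1) x_orth x_unit
    by (auto simp: orthonormal_upto_def less_Suc_eq inner_commute[of "w _" x]
             simp del: inner_scaleR_left inner_scaleR_right)
       (auto simp: x_orth inner_commute[of "w _" x])
  moreover have "\<forall>i<r. (w(m := x /\<^sub>R norm x)) i = u i"
    using w(2) step.hyps by auto
  ultimately show ?case by blast
qed

section \<open>The spectral theorem for self-adjoint maps\<close>

text \<open>
  The spectral theorem, with the eigenvalues in decreasing order. The quadratic form
  \<open>f x \<bullet> x\<close> attains its maximum over the compact unit sphere of \<open>S\<close>; a maximiser is an eigenvector,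
  and self-adjointness makes its orthogonal complement in \<open>S\<close> invariant, so induction on the
  dimension applies there. The order comes for free, because the maximum over the complement is at
  most the maximum over \<open>S\<close>.
\<close>

lemma self_adjoint_sorted_eigenbasis:
  fixes f :: "'a::euclidean_space \<Rightarrow> 'a"
  assumes f: "linear f" and self_adj: "\<And>x y. f x \<bullet> y = x \<bullet> f y"
    and "subspace S" and "f ` S \<subseteq> S" and "dim S = m"
  shows "\<exists>v l. orthonormal_upto m v \<and>
               (\<forall>i<m. v i \<in> S \<and> f (v i) = l i *\<^sub>R v i) \<and>
               (\<forall>i j. i \<le> j \<longrightarrow> j < m \<longrightarrow> l j \<le> (l i :: real))"
  using assms(3-5)
proof (induction m arbitrary: S)
  case 0
  then show ?case by (auto simp: orthonormal_upto_def)
next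
  case (Suc m)
  define K where "K = S \<inter> sphere 0 1"
  obtain y where "y \<in> S" "y \<noteq> 0"
    using Suc.prems(1,3) by (metis Zero_not_Suc dim_eq_0 insertCI subsetI)
  then have "y /\<^sub>R norm y \<in> K"
    using Suc.prems(1) by (auto simp: K_def subspace_scale)
  then have "K \<noteq> {}" by blast
  moreover have "compact K"
    unfolding K_def using closed_subspace[OF Suc.prems(1)] by (metis closed_Int_compact compact_sphere)
  moreover have "continuous_on K (\<lambda>x. f x \<bullet> x)"
    using f by (intro continuous_intros linear_continuous_on) (simp add: linear_conv_bounded_linear)
  ultimately obtain v where v: "v \<in> K" and vmax: "\<And>x. x \<in> K \<Longrightarrow> f x \<bullet> x \<le> f v \<bullet> v"
    using continuous_attains_sup[of K "\<lambda>x. f x \<bullet> x"] by blast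
  define c where "c = f v \<bullet> v"
  have vS: "v \<in> S" and vv: "v \<bullet> v = 1"
    using v by (auto simp: K_def norm_eq_1)
  have defect_nonneg: "0 \<le> c * (x \<bullet> x) - f x \<bullet> x" if "x \<in> S" for x
  proof (cases "x = 0")
    case True
    then show ?thesis by simp
  next
    case False
    have "x /\<^sub>R norm x \<in> K"
      using that False Suc.prems(1) by (auto simp: K_def subspace_scale)
    from vmax[OF this] have "(f x \<bullet> x) / (norm x * norm x) \<le> c"
      using f by (simp add: c_def linear_scale divide_inverse ac_simps)
    then show ?thesis
      using False by (simp add: divide_le_eq dot_square_norm power2_eq_square)
  qed
  have eigen: "f v = c *\<^sub>R v"
  proof -
    define w where "w = c *\<^sub>R v - f v"
    have fvS: "f v \<in> S" using vS Suc.prems(2) by auto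
    have wS: "w \<in> S"
      unfolding w_def using vS fvS Suc.prems(1) by (auto intro!: subspace_diff subspace_scale)
    define b where "b = c * (w \<bullet> w) - f w \<bullet> w"
    \<comment> \<open>The defect form vanishes at \<open>v\<close>, so along the line through \<open>v\<close> with direction \<open>w\<close>
      only the linear and the quadratic term in \<open>e\<close> remain.\<close>
    have quad: "0 \<le> 2 * e * (w \<bullet> w) + e\<^sup>2 * b" for e
    proof -
      have "v + e *\<^sub>R w \<in> S"
        using vS wS Suc.prems(1) by (auto intro!: subspace_add subspace_scale)
      from defect_nonneg[OF this]
      have "0 \<le> c * ((v + e *\<^sub>R w) \<bullet> (v + e *\<^sub>R w)) - f (v + e *\<^sub>R w) \<bullet> (v + e *\<^sub>R w)" .
      also have "\<dots> = (c * (v \<bullet> v) - f v \<bullet> v) + 2 * e * (c * (v \<bullet> w) - f v \<bullet> w) + e\<^sup>2 * b"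
      proof -
        have "w \<bullet> v = v \<bullet> w" and "f w \<bullet> v = f v \<bullet> w"
          using self_adj[of w v] by (simp_all add: inner_commute)
        then show ?thesis
          by (simp add: b_def linear_add[OF f] linear_scale[OF f] algebra_simps power2_eq_square)
      qed
      also have "c * (v \<bullet> v) - f v \<bullet> v = 0"
        by (simp add: c_def vv)
      also have "c * (v \<bullet> w) - f v \<bullet> w = w \<bullet> w"
        by (simp add: w_def inner_diff_left inner_diff_right inner_commute[of v "f v"])
      finally show ?thesis by simp
    qed
    have "w \<bullet> w = 0"
    proof (rule ccontr)
      assume "w \<bullet> w \<noteq> 0"
      then have a: "w \<bullet> w > 0" by simp
      \<comment> \<open>A negative \<open>e\<close> chosen so that \<open>\<bar>e * b\<bar> < w \<bullet> w\<close>, which makes the expression in \<open>quad\<close> negative.\<close>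
      define e where "e = - (w \<bullet> w) / (\<bar>b\<bar> + 1)"
      have "e < 0" using a by (simp add: e_def divide_neg_pos)
      have "e\<^sup>2 * b \<le> e\<^sup>2 * (\<bar>b\<bar> + 1)"
        by (intro mult_left_mono) auto
      also have "\<dots> = e * (e * (\<bar>b\<bar> + 1))"
        by (simp add: power2_eq_square)
      also have "e * (\<bar>b\<bar> + 1) = - (w \<bullet> w)"
        by (simp add: e_def)
      finally have "2 * e * (w \<bullet> w) + e\<^sup>2 * b \<le> e * (w \<bullet> w)" by simp
      also have "\<dots> < 0" using \<open>e < 0\<close> a by (rule mult_neg_pos)
      finally show False using quad[of e] by simp
    qed
    then show ?thesis by (simp add: w_def)
  qed
  define S' where "S' = {x \<in> S. \<forall>y \<in> span {v}. orthogonal y x}"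
  have S'_iff: "x \<in> S' \<longleftrightarrow> x \<in> S \<and> v \<bullet> x = 0" for x
    by (auto simp: S'_def span_singleton orthogonal_def)
  have sub': "subspace S'"
    using Suc.prems(1) by (auto simp: subspace_def S'_iff inner_add_right)
  have inv': "f ` S' \<subseteq> S'"
    using Suc.prems(2) by (auto simp: S'_iff image_subset_iff eigen simp flip: self_adj)
  have "dim S' + dim (span {v}) = dim S"
    unfolding S'_def
    by (rule dim_subspace_orthogonal_to_vectors) (use Suc.prems(1) vS in \<open>auto simp: span_minimal\<close>)
  moreover have "dim (span {v}) = 1"
    using vv by (auto simp: dim_span dim_insert simp del: dim_singleton)
  ultimately have dim': "dim S' = m"
    using Suc.prems(3) by simp
  obtain v' l' where IH: "orthonormal_upto m v'"
      "\<And>i. i < m \<Longrightarrow> v' i \<in> S' \<and> f (v' i) = l' i *\<^sub>R v' i"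
      "\<And>i j. i \<le> j \<Longrightarrow> j < m \<Longrightarrow> l' j \<le> l' i"
    using Suc.IH[OF sub' inv' dim'] by blast
  have v'_unit: "v' i \<bullet> v' i = 1" if "i < m" for i
    using IH(1) that by (simp add: orthonormal_upto_def)
  have le_c: "l' i \<le> c" if "i < m" for i
    using defect_nonneg[of "v' i"] IH(2)[OF that] v'_unit[OF that] by (auto simp: S'_iff)
  have "orthonormal_upto (Suc m) (case_nat v v')"
  proof -
    have "v \<bullet> v' i = 0" "v' i \<bullet> v = 0" if "i < m" for i
      using IH(2)[OF that] by (simp_all add: S'_iff inner_commute)
    then show ?thesis
      using IH(1) vv by (auto simp: orthonormal_upto_def split: nat.split)
  qed
  moreover have "\<forall>i<Suc m. case_nat v v' i \<in> S \<and>
      f (case_nat v v' i) = case_nat c l' i *\<^sub>R case_nat v v' i"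
    using IH(2) vS eigen by (auto simp: S'_iff split: nat.split)
  moreover have "\<forall>i j. i \<le> j \<longrightarrow> j < Suc m \<longrightarrow> case_nat c l' j \<le> case_nat c l' i"
    using IH(3) le_c by (auto split: nat.split)
  ultimately show ?case by blast
qed

section \<open>Existence of ordered singular value decompositions\<close>

lemma downward_closed_eq_lessThan:
  fixes J :: "nat set"
  assumes "finite J" and down: "\<And>i j. i \<le> j \<Longrightarrow> j \<in> J \<Longrightarrow> i \<in> J"
  shows "J = {..<card J}"
proof (rule card_subset_eq)
  show "J \<subseteq> {..<card J}"
  proof
    fix j assume "j \<in> J"
    then have "{..j} \<subseteq> J" using down by auto
    from card_mono[OF \<open>finite J\<close> this] show "j \<in> {..<card J}" by simp
  qed
qed simp_all

text \<open>
  The definition of \<open>rect_diag\<close> matches rows with columns through this enumeration, which lets sums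
  over row or column indices become sums over \<open>{..<CARD('a)}\<close>.
\<close>

abbreviation position :: "'a::finite \<Rightarrow> nat" where
  "position \<equiv> to_nat_on UNIV"

lemma bij_betw_position: "bij_betw (position :: 'a::finite \<Rightarrow> nat) UNIV {..<CARD('a)}"
  by (rule to_nat_on_finite) simp

lemma position_less: "position (i :: 'a::finite) < CARD('a)"
  using bij_betw_position[where 'a = 'a] by (auto dest: bij_betwE)

lemma position_surj:
  assumes "p < CARD('a)"
  obtains i :: "'a::finite" where "position i = p"
  using bij_betw_position[where 'a = 'a] assms unfolding bij_betw_def by (metis imageE lessThan_iff)

lemma sum_over_position: "(\<Sum>i\<in>UNIV. h (position (i :: 'a::finite))) = (\<Sum>p<CARD('a). h p)"
  using bij_betw_position by (rule sum.reindex_bij_betw)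

definition matrix_of_columns :: "(nat \<Rightarrow> real ^ 'n) \<Rightarrow> real ^ 'm ^ 'n" where
  "matrix_of_columns u = (\<chi> i j. u (position j) $ i)"

lemma column_matrix_of_columns: "column j (matrix_of_columns u) = u (position j)"
  by (simp add: matrix_of_columns_def column_def vec_eq_iff)

lemma orthogonal_matrix_of_columns:
  fixes u :: "nat \<Rightarrow> real ^ 'n"
  assumes "orthonormal_upto CARD('n) u"
  shows "orthogonal_matrix (matrix_of_columns u :: real ^ 'n ^ 'n)"
  using assms position_less[where 'a = 'n]
  by (auto simp: orthogonal_matrix_orthonormal_columns column_matrix_of_columns
      orthonormal_upto_def norm_eq_1 orthogonal_def)

lemma matrix_mult_columns:
  fixes Q :: "real ^ 'k ^ 'n" and v :: "nat \<Rightarrow> real ^ 'k"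
  shows "Q ** (matrix_of_columns v :: real ^ 'm ^ 'k) = matrix_of_columns (\<lambda>j. Q *v v j)"
  by (simp add: matrix_of_columns_def matrix_matrix_mult_def matrix_vector_mult_def vec_eq_iff)

lemma columns_mult_rect_diag:
  fixes u :: "nat \<Rightarrow> real ^ 'm"
  assumes "length s \<le> CARD('n)"
  shows "(matrix_of_columns u :: real ^ 'n ^ 'm) ** (rect_diag s :: real ^ 'k ^ 'n)
       = matrix_of_columns (\<lambda>j. if j < length s then (s ! j) *\<^sub>R u j else 0)"
proof -
  have "(\<Sum>p\<in>UNIV. u (position (p :: 'n)) $ a * (rect_diag s :: real ^ 'k ^ 'n) $ p $ q)
      = (if position q < length s then s ! position q * u (position q) $ a else 0)" for a q
  proof -
    let ?h = "\<lambda>p. if p = position q then if p < length s then s ! p * u p $ a else 0 else 0"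
    have "(\<Sum>p\<in>UNIV. u (position (p :: 'n)) $ a * (rect_diag s :: real ^ 'k ^ 'n) $ p $ q)
        = (\<Sum>p\<in>UNIV. ?h (position (p :: 'n)))"
      by (intro sum.cong) (auto simp: rect_diag_def Let_def)
    also have "\<dots> = (\<Sum>p<CARD('n). ?h p)"
      by (rule sum_over_position[of ?h])
    also have "\<dots> = (if position q < length s then s ! position q * u (position q) $ a else 0)"
      using assms by (auto simp: sum.delta)
    finally show ?thesis .
  qed
  then show ?thesis
    by (auto simp: matrix_of_columns_def matrix_matrix_mult_def vec_eq_iff)
qed

text \<open>
  The right singular vectors \<open>v i\<close> are eigenvectors of the Gram matrix of \<open>Q\<close>, with decreasing
  eigenvalues \<open>l i\<close>. The images \<open>Q *v v i\<close> are orthogonal with squared lengths \<open>l i\<close>. So, after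
  normalisation, those with \<open>l i > 0\<close> form an orthonormal family in the target space, which is
  extended to a full basis.
\<close>

lemma is_ordered_svd_exists:
  fixes Q :: "real ^ 'k ^ 'n"
  shows "\<exists>A s B. is_ordered_svd Q A s B"
proof -
  define f where "f = (\<lambda>x. transpose Q *v (Q *v x))"
  have f_inner: "f x \<bullet> y = (Q *v x) \<bullet> (Q *v y)" for x y
    by (metis f_def dot_lmul_matrix transpose_transpose vector_transpose_matrix)
  have "linear f"
    by (simp add: f_def matrix_vector_mul_assoc)
  moreover have "f x \<bullet> y = x \<bullet> f y" for x y
    by (metis f_inner inner_commute)
  ultimately obtain v l where v: "orthonormal_upto CARD('k) v"
    and eig: "\<And>i. i < CARD('k) \<Longrightarrow> f (v i) = l i *\<^sub>R v i"
    and sorted: "\<And>i j. i \<le> j \<Longrightarrow> j < CARD('k) \<Longrightarrow> l j \<le> (l i :: real)"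
    using self_adjoint_sorted_eigenbasis[of f UNIV "CARD('k)"] by auto
  have Qv_inner: "(Q *v v i) \<bullet> (Q *v v j) = (if i = j then l i else 0)"
    if "i < CARD('k)" "j < CARD('k)" for i j
    using v that by (simp add: eig orthonormal_upto_def flip: f_inner)
  have l_nonneg: "0 \<le> l i" if "i < CARD('k)" for i
    using Qv_inner[OF that that] by (metis inner_ge_zero)
  define r where "r = card {i. i < CARD('k) \<and> l i > 0}"
  have pos_iff: "l i > 0 \<longleftrightarrow> i < r" if "i < CARD('k)" for i
  proof -
    define J where "J = {i. i < CARD('k) \<and> l i > 0}"
    have "J = {..<card J}"
      by (rule downward_closed_eq_lessThan) (auto simp: J_def dest: sorted)
    then have "i \<in> J \<longleftrightarrow> i < card J" by blast
    then show ?thesis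
      using that by (simp add: J_def r_def)
  qed
  have "r \<le> CARD('k)"
    unfolding r_def using card_mono[of "{..<CARD('k)}"] by (auto simp: subset_iff)
  have u0: "orthonormal_upto r (\<lambda>i. (Q *v v i) /\<^sub>R sqrt (l i))"
  proof -
    have "0 < l i" "i < CARD('k)" if "i < r" for i
      using that \<open>r \<le> CARD('k)\<close> pos_iff[of i] by auto
    then show ?thesis
      by (auto simp: orthonormal_upto_def Qv_inner field_simps abs_of_pos less_imp_neq[symmetric])
  qed
  \<comment> \<open>Orthonormal families are no longer than the dimension. Hence every \<open>l j\<close> with an index beyond
    the length \<open>min CARD('n) CARD('k)\<close> of the list vanishes.\<close>
  have "r \<le> CARD('n)"
    using orthonormal_upto_le_DIM[OF u0] by simp
  obtain u where u: "orthonormal_upto CARD('n) u"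
    and u_eq: "\<And>i. i < r \<Longrightarrow> u i = (Q *v v i) /\<^sub>R sqrt (l i)"
    using orthonormal_upto_extend[OF u0 \<open>r \<le> CARD('n)\<close>] by auto
  define s where "s = map (\<lambda>i. sqrt (l i)) [0..<min CARD('n) CARD('k)]"
  have len: "length s = min CARD('n) CARD('k)"
    by (simp add: s_def)
  define A where "A = (matrix_of_columns u :: real ^ 'n ^ 'n)"
  define B where "B = (matrix_of_columns v :: real ^ 'k ^ 'k)"
  have orth: "orthogonal_matrix A" "orthogonal_matrix B"
    unfolding A_def B_def using u v by (auto intro: orthogonal_matrix_of_columns)
  have action: "Q *v v j = (if j < length s then (s ! j) *\<^sub>R u j else 0)" if "j < CARD('k)" for j
  proof (cases "j < r")
    case True
    then show ?thesis
      using pos_iff[OF that] \<open>r \<le> CARD('n)\<close> that by (auto simp: len s_def u_eq)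
  next
    case False
    then have "l j = 0"
      using pos_iff[OF that] l_nonneg[OF that] by simp
    moreover have "Q *v v j = 0"
      using Qv_inner[OF that that] \<open>l j = 0\<close> by simp
    ultimately show ?thesis
      by (simp add: s_def)
  qed
  have "Q ** B = A ** rect_diag s"
    unfolding A_def B_def matrix_mult_columns
    by (subst columns_mult_rect_diag) (auto simp: len matrix_of_columns_def vec_eq_iff action position_less)
  then have "Q = A ** rect_diag s ** transpose B"
    using orth(2) by (metis matrix_mul_assoc matrix_mul_rid orthogonal_matrix_def)
  moreover have "\<forall>x\<in>set s. 0 \<le> x"
    using l_nonneg by (auto simp: s_def)
  moreover have "sorted_wrt (\<ge>) s"
    using sorted by (auto simp: s_def sorted_wrt_iff_nth_less)
  ultimately have "is_ordered_svd Q A s B"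
    using orth len by (simp only: is_ordered_svd_def is_svd_def simp_thms)
  then show ?thesis by blast
qed

section \<open>Counting singular values above a level\<close>

lemma power2_norm_eq_sum:
  fixes y :: "real ^ 'm"
  shows "(norm y)\<^sup>2 = (\<Sum>i\<in>UNIV. (y $ i)\<^sup>2)"
  unfolding power2_norm_eq_inner inner_vec_def by (simp add: power2_eq_square)

lemma orthogonal_matrix_norm:
  fixes C :: "real ^ 'm ^ 'm"
  assumes "orthogonal_matrix C"
  shows "norm (C *v x) = norm x"
proof -
  have "(C *v x) \<bullet> (C *v x) = (transpose C *v (C *v x)) \<bullet> x"
    by (simp only: transpose_matrix_vector dot_lmul_matrix)
  also have "\<dots> = x \<bullet> x"
    using assms by (simp only: matrix_vector_mul_assoc orthogonal_matrix_def matrix_vector_mul_lid)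
  finally show ?thesis by (simp add: norm_eq)
qed

text \<open>
  The only consequence of a decomposition that the estimates below need: in coordinates along the
  right singular vectors, both squared norms are diagonal. The left factor disappears because it
  preserves norms.
\<close>

lemma is_svd_norms:
  fixes Q :: "real ^ 'k ^ 'n"
  assumes "is_svd Q A s B"
  obtains v where "orthonormal_upto CARD('k) v"
    and "\<And>x. (norm x)\<^sup>2 = (\<Sum>j<CARD('k). (v j \<bullet> x)\<^sup>2)"
    and "\<And>x. (norm (Q *v x))\<^sup>2 = (\<Sum>j<length s. (s ! j)\<^sup>2 * (v j \<bullet> x)\<^sup>2)"
proof -
  have A: "orthogonal_matrix A" and B: "orthogonal_matrix B"
    and len: "length s \<le> min CARD('n) CARD('k)"
    and Q: "Q = A ** rect_diag s ** transpose B"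
    using assms by (simp_all add: is_svd_def)
  \<comment> \<open>The default rewriting of \<open>transpose B *v x\<close> to \<open>x v* B\<close> hides the product of matrices.\<close>
  note transpose_matrix_vector [simp del]
  let ?D = "rect_diag s :: real ^ 'k ^ 'n"
  define idx where "idx = (inv_into UNIV (position :: 'k \<Rightarrow> nat))"
  have idx_position: "idx (position q) = q" for q
    unfolding idx_def by (intro inv_into_f_f inj_onI) auto
  define v where "v = (\<lambda>j. column (idx j) B)"
  have v_position: "v (position q) = column q B" for q
    by (simp add: v_def idx_position)
  have coord: "(transpose B *v x) $ q = v (position q) \<bullet> x" for x q
    by (simp add: v_position matrix_vector_mul_component transpose_def column_def)
  have "orthonormal_upto CARD('k) v"
    unfolding orthonormal_upto_def
  proof (intro allI impI)
    fix i j assume "i < CARD('k)" "j < CARD('k)"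
    then obtain p q :: 'k where "position p = i" "position q = j"
      by (metis position_surj)
    then show "v i \<bullet> v j = (if i = j then 1 else 0)"
      using B v_position[of p] v_position[of q]
      by (auto simp: orthogonal_matrix_orthonormal_columns norm_eq_1 orthogonal_def)
  qed
  moreover have "(norm x)\<^sup>2 = (\<Sum>j<CARD('k). (v j \<bullet> x)\<^sup>2)" for x
  proof -
    have "(norm x)\<^sup>2 = (norm (transpose B *v x))\<^sup>2"
      using B by (simp add: orthogonal_matrix_norm)
    also have "\<dots> = (\<Sum>q\<in>UNIV. (v (position (q :: 'k)) \<bullet> x)\<^sup>2)"
      by (simp add: power2_norm_eq_sum coord)
    finally show ?thesis
      by (simp add: sum_over_position[of "\<lambda>j. (v j \<bullet> x)\<^sup>2"])
  qed
  moreover have "(norm (Q *v x))\<^sup>2 = (\<Sum>j<length s. (s ! j)\<^sup>2 * (v j \<bullet> x)\<^sup>2)" for x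
  proof -
    have D: "(?D *v (transpose B *v x)) $ p
        = (if position p < length s then s ! position p * (v (position p) \<bullet> x) else 0)" for p
    proof -
      let ?h = "\<lambda>j. if j = position p then if j < length s then s ! j * (v j \<bullet> x) else 0 else 0"
      have "(?D *v (transpose B *v x)) $ p = (\<Sum>q\<in>UNIV. ?h (position (q :: 'k)))"
        unfolding matrix_vector_mult_def[of ?D]
        by (auto intro!: sum.cong simp: coord rect_diag_def Let_def)
      also have "\<dots> = (\<Sum>j<CARD('k). ?h j)"
        by (rule sum_over_position[of ?h])
      also have "\<dots> = (if position p < length s then s ! position p * (v (position p) \<bullet> x) else 0)"
        using len by (auto simp: sum.delta)
      finally show ?thesis .
    qed
    let ?h = "\<lambda>j. if j < length s then (s ! j)\<^sup>2 * (v j \<bullet> x)\<^sup>2 else 0"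
    have "(norm (Q *v x))\<^sup>2 = (norm (A *v (?D *v (transpose B *v x))))\<^sup>2"
      by (simp add: Q matrix_vector_mul_assoc matrix_mul_assoc)
    also have "\<dots> = (norm (?D *v (transpose B *v x)))\<^sup>2"
      using A by (simp add: orthogonal_matrix_norm)
    also have "\<dots> = (\<Sum>p\<in>UNIV. ?h (position (p :: 'n)))"
      unfolding power2_norm_eq_sum by (intro sum.cong) (auto simp: D power_mult_distrib)
    also have "\<dots> = (\<Sum>j<CARD('n). ?h j)"
      by (rule sum_over_position[of ?h])
    also have "\<dots> = (\<Sum>j<length s. (s ! j)\<^sup>2 * (v j \<bullet> x)\<^sup>2)"
      using len by (intro sum.mono_neutral_cong_right) auto
    finally show ?thesis .
  qed
  ultimately show ?thesis by (rule that)
qed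

lemma is_svd_length:
  fixes Q :: "real ^ 'k ^ 'n"
  assumes "is_svd Q A s B"
  shows "length s \<le> CARD('k)" and "s \<noteq> []"
  using assms by (auto simp: is_svd_def min_def split: if_splits)

lemma is_svd_nonneg: "is_svd Q A s B \<Longrightarrow> j < length s \<Longrightarrow> 0 \<le> s ! j"
  by (simp add: is_svd_def)

text \<open>
  The counting half of the Courant-Fischer principle. On the span of the right singular vectors
  with singular value above \<open>c\<close>, the matrix stretches every nonzero vector by more than \<open>c\<close>. This
  span therefore meets \<open>N\<close> only in zero, and the two dimensions add up to at most that of the space.
\<close>

lemma svd_count_bound:
  fixes Q :: "real ^ 'k ^ 'n"
  assumes svd: "is_svd Q A s B" and "0 \<le> c" and "subspace N"
    and N: "\<And>x. x \<in> N \<Longrightarrow> norm (Q *v x) \<le> c * norm x"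
  shows "card {j. j < length s \<and> c < s ! j} + dim N \<le> CARD('k)"
proof -
  obtain v where v: "orthonormal_upto CARD('k) v"
    and norm_x: "\<And>x. (norm x)\<^sup>2 = (\<Sum>j<CARD('k). (v j \<bullet> x)\<^sup>2)"
    and norm_Qx: "\<And>x. (norm (Q *v x))\<^sup>2 = (\<Sum>j<length s. (s ! j)\<^sup>2 * (v j \<bullet> x)\<^sup>2)"
    using is_svd_norms[OF svd] by blast
  define J where "J = {j. j < length s \<and> c < s ! j}"
  have J: "J \<subseteq> {..<length s}" "J \<subseteq> {..<CARD('k)}" "finite J"
    using is_svd_length(1)[OF svd] by (auto simp: J_def)
  define W where "W = span (v ` J)"
  have "x = 0" if "x \<in> W" "x \<in> N" for x
  proof -
    have zero: "v j \<bullet> x = 0" if "j < CARD('k)" "j \<notin> J" for j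
      using inner_zero_outside_span[OF v J(2)] \<open>x \<in> W\<close> that by (simp add: W_def)
    have x_J: "(norm x)\<^sup>2 = (\<Sum>j\<in>J. (v j \<bullet> x)\<^sup>2)"
      unfolding norm_x using J zero by (intro sum.mono_neutral_right) auto
    have "(norm (Q *v x))\<^sup>2 = (\<Sum>j\<in>J. (s ! j)\<^sup>2 * (v j \<bullet> x)\<^sup>2)"
      unfolding norm_Qx using J zero is_svd_length(1)[OF svd] by (intro sum.mono_neutral_right) auto
    moreover have "(norm (Q *v x))\<^sup>2 \<le> c\<^sup>2 * (norm x)\<^sup>2"
      using power_mono[OF N[OF \<open>x \<in> N\<close>] norm_ge_zero, of 2] by (simp add: power_mult_distrib)
    ultimately have "(\<Sum>j\<in>J. ((s ! j)\<^sup>2 - c\<^sup>2) * (v j \<bullet> x)\<^sup>2) \<le> 0"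
      by (simp add: x_J sum_distrib_left left_diff_distrib sum_subtractf)
    moreover have gap: "0 < (s ! j)\<^sup>2 - c\<^sup>2" if "j \<in> J" for j
      using that \<open>0 \<le> c\<close> by (simp add: J_def power_strict_mono)
    then have nonneg: "0 \<le> ((s ! j)\<^sup>2 - c\<^sup>2) * (v j \<bullet> x)\<^sup>2" if "j \<in> J" for j
      using that by (simp add: less_imp_le)
    ultimately have "(\<Sum>j\<in>J. ((s ! j)\<^sup>2 - c\<^sup>2) * (v j \<bullet> x)\<^sup>2) = 0"
      by (meson antisym sum_nonneg)
    then have "\<forall>j\<in>J. ((s ! j)\<^sup>2 - c\<^sup>2) * (v j \<bullet> x)\<^sup>2 = 0"
      using J(3) nonneg by (simp add: sum_nonneg_eq_0_iff)
    then have "\<forall>j\<in>J. v j \<bullet> x = 0"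
      using gap by force
    then show ?thesis
      using x_J by simp
  qed
  then have "W \<inter> N \<subseteq> {0}" by blast
  then have "dim (W \<inter> N) = 0"
    by (simp add: dim_eq_0)
  moreover have "dim {x + y |x y. x \<in> W \<and> y \<in> N} + dim (W \<inter> N) = dim W + dim N"
    by (intro dim_sums_Int) (auto simp: W_def \<open>subspace N\<close>)
  moreover have "dim {x + y |x y. x \<in> W \<and> y \<in> N} \<le> CARD('k)"
    using dim_subset_UNIV[of "{x + y |x y. x \<in> W \<and> y \<in> N}"] by simp
  moreover have "dim W = card J"
    unfolding W_def using v J(2) by (rule orthonormal_upto_dim_span)
  ultimately have "card J + dim N \<le> CARD('k)" by linarith
  then show ?thesis by (simp only: J_def)
qed

text \<open>
  The bound of \<open>svd_count_bound\<close> is sharp: the remaining right singular vectors span a suitable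
  subspace. For \<open>c = 0\<close> this subspace is the kernel of \<open>Q\<close>.
\<close>

lemma svd_count_attained:
  fixes Q :: "real ^ 'k ^ 'n"
  assumes svd: "is_svd Q A s B" and "0 \<le> c"
  obtains N where "subspace N" and "\<And>x. x \<in> N \<Longrightarrow> norm (Q *v x) \<le> c * norm x"
    and "card {j. j < length s \<and> c < s ! j} + dim N = CARD('k)"
proof -
  obtain v where v: "orthonormal_upto CARD('k) v"
    and norm_x: "\<And>x. (norm x)\<^sup>2 = (\<Sum>j<CARD('k). (v j \<bullet> x)\<^sup>2)"
    and norm_Qx: "\<And>x. (norm (Q *v x))\<^sup>2 = (\<Sum>j<length s. (s ! j)\<^sup>2 * (v j \<bullet> x)\<^sup>2)"
    using is_svd_norms[OF svd] by blast
  define J where "J = {j. j < length s \<and> c < s ! j}"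
  have J: "J \<subseteq> {..<CARD('k)}"
    using is_svd_length(1)[OF svd] by (auto simp: J_def)
  define N where "N = span (v ` ({..<CARD('k)} - J))"
  have "norm (Q *v x) \<le> c * norm x" if "x \<in> N" for x
  proof -
    have zero: "v j \<bullet> x = 0" if "j \<in> J" for j
      using inner_zero_outside_span[OF v, of "{..<CARD('k)} - J" x j] \<open>x \<in> N\<close> that J
      by (auto simp: N_def)
    have "(norm (Q *v x))\<^sup>2 \<le> (\<Sum>j<length s. c\<^sup>2 * (v j \<bullet> x)\<^sup>2)"
      unfolding norm_Qx
    proof (rule sum_mono)
      fix j assume j: "j \<in> {..<length s}"
      show "(s ! j)\<^sup>2 * (v j \<bullet> x)\<^sup>2 \<le> c\<^sup>2 * (v j \<bullet> x)\<^sup>2"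
      proof (cases "j \<in> J")
        case True
        then show ?thesis by (simp add: zero)
      next
        case False
        then show ?thesis
          using j is_svd_nonneg[OF svd] by (auto simp: J_def intro!: mult_right_mono power_mono)
      qed
    qed
    also have "\<dots> \<le> (\<Sum>j<CARD('k). c\<^sup>2 * (v j \<bullet> x)\<^sup>2)"
      using is_svd_length(1)[OF svd] by (intro sum_mono2) auto
    also have "\<dots> = (c * norm x)\<^sup>2"
      by (simp add: norm_x power_mult_distrib flip: sum_distrib_left)
    finally show ?thesis
      by (rule power2_le_imp_le) (simp add: \<open>0 \<le> c\<close>)
  qed
  moreover have "dim N = CARD('k) - card J"
    unfolding N_def using J
    by (subst orthonormal_upto_dim_span[OF v]) (auto simp: card_Diff_subset finite_subset)
  moreover have "card J \<le> CARD('k)"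
    using card_mono[OF _ J] by simp
  ultimately show ?thesis
    using that[of N] by (simp add: N_def J_def)
qed

text \<open>
  Comparing one decomposition with the extremal subspace of another shows that the number of
  singular values above a level depends on the matrix alone.
\<close>

lemma svd_count_unique:
  assumes "is_svd Q A s B" and "is_svd Q A' s' B'" and "0 \<le> c"
  shows "card {j. j < length s \<and> c < s ! j} = card {j. j < length s' \<and> c < s' ! j}"
proof -
  have le: "card {j. j < length s \<and> c < s ! j} \<le> card {j. j < length s' \<and> c < s' ! j}"
    if svds: "is_svd Q A s B" "is_svd Q A' s' B'" for A s B A' s' B'
  proof (rule svd_count_attained[OF svds(2) \<open>0 \<le> c\<close>])
    fix N
    assume "subspace N" "\<And>x. x \<in> N \<Longrightarrow> norm (Q *v x) \<le> c * norm x"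
      and card': "card {j. j < length s' \<and> c < s' ! j} + dim N = CARD('a)"
    with svd_count_bound[OF svds(1) \<open>0 \<le> c\<close>]
    have "card {j. j < length s \<and> c < s ! j} + dim N \<le> CARD('a)" by blast
    then show ?thesis using card' by linarith
  qed
  show ?thesis
    using le assms by (meson antisym)
qed

section \<open>Uniqueness and supports of singular values\<close>

lemma sorted_superlevel_set:
  fixes s :: "real list"
  assumes "sorted_wrt (\<ge>) s"
  shows "{j. j < length s \<and> c < s ! j} = {..<card {j. j < length s \<and> c < s ! j}}"
proof (rule downward_closed_eq_lessThan)
  fix i j assume "i \<le> j" "j \<in> {j. j < length s \<and> c < s ! j}"
  moreover from this have "s ! j \<le> s ! i"
    using assms by (cases "i = j") (auto simp: sorted_wrt_iff_nth_less)
  ultimately show "i \<in> {j. j < length s \<and> c < s ! j}" by auto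
qed simp

text \<open>
  A decreasing list is determined by the sizes of its superlevel sets, and the level that separates
  two differing entries may be taken to be the smaller of them, which is nonnegative as
  \<open>svd_count_unique\<close> demands.
\<close>

lemma ordered_svd_unique:
  fixes Q :: "real ^ 'k ^ 'n"
  assumes "is_ordered_svd Q A s B" and "is_ordered_svd Q A' s' B'"
  shows "s = s'"
proof (rule nth_equalityI)
  show len: "length s = length s'"
    using assms by (simp add: is_ordered_svd_def is_svd_def)
  fix j assume j: "j < length s"
  have le: "s ! j \<le> s' ! j"
    if o: "is_ordered_svd Q A s B" "is_ordered_svd Q A' s' B'" and j: "j < length s" "j < length s'"
    for A s B A' s' B'
  proof (rule ccontr)
    let ?c = "s' ! j"
    have svds: "is_svd Q A s B" "is_svd Q A' s' B'" and sorted: "sorted_wrt (\<ge>) s" "sorted_wrt (\<ge>) s'"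
      using o by (simp_all add: is_ordered_svd_def)
    assume "\<not> s ! j \<le> ?c"
    then have "j \<in> {i. i < length s \<and> ?c < s ! i}" using j by simp
    also have "\<dots> = {..<card {i. i < length s \<and> ?c < s ! i}}"
      by (rule sorted_superlevel_set[OF sorted(1)])
    also have "\<dots> = {..<card {i. i < length s' \<and> ?c < s' ! i}}"
      using svd_count_unique[OF svds is_svd_nonneg[OF svds(2) j(2)]] by simp
    also have "\<dots> = {i. i < length s' \<and> ?c < s' ! i}"
      by (rule sorted_superlevel_set[OF sorted(2), symmetric])
    finally show False by simp
  qed
  show "s ! j = s' ! j"
    using le[OF assms] le[OF assms(2,1)] j len by (simp add: antisym)
qed

lemma singular_values_svd:
  fixes Q :: "real ^ 'k ^ 'n"
  obtains A B where "is_ordered_svd Q A (singular_values Q) B"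
proof -
  have "\<exists>!s. \<exists>A B. is_ordered_svd Q A s B"
    using is_ordered_svd_exists[of Q] ordered_svd_unique by blast
  from theI'[OF this] that show ?thesis
    unfolding singular_values_def by blast
qed

lemma is_svd_supp:
  assumes "is_svd Q A s B"
  shows "supp s = {j. j < length s \<and> 0 < s ! j}"
  using is_svd_nonneg[OF assms] by (force simp: supp_def)

text \<open>
  Since the singular values decrease, supports are initial segments; inclusion of supports
  is thus comparison of their sizes.
\<close>

lemma supp_singular_values:
  "supp (singular_values Q) = {..<card (supp (singular_values Q))}"
proof -
  obtain A B where "is_ordered_svd Q A (singular_values Q) B"
    by (rule singular_values_svd)
  then have svd: "is_svd Q A (singular_values Q) B" and "sorted_wrt (\<ge>) (singular_values Q)"
    by (simp_all add: is_ordered_svd_def)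
  then show ?thesis
    unfolding is_svd_supp[OF svd] by (intro sorted_superlevel_set)
qed

text \<open>
  Thresholding and projection produce decompositions whose lists need not be ordered. This lemma
  allows reading off the size of the support from them without sorting.
\<close>

lemma card_supp_svd:
  assumes "is_svd Q A s B"
  shows "card (supp (singular_values Q)) = card (supp s)"
proof -
  obtain A' B' where "is_ordered_svd Q A' (singular_values Q) B'"
    by (rule singular_values_svd)
  then have svd: "is_svd Q A' (singular_values Q) B'"
    by (simp add: is_ordered_svd_def)
  then show ?thesis
    using svd_count_unique[OF svd assms, of 0] by (simp add: is_svd_supp[OF svd] is_svd_supp[OF assms])
qed

lemma norm_le_sigma_max:
  fixes Q :: "real ^ 'k ^ 'n"
  shows "norm (Q *v x) \<le> sigma_max Q * norm x"
proof -
  let ?s = "singular_values Q"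
  obtain A B where "is_ordered_svd Q A ?s B"
    by (rule singular_values_svd)
  then have svd: "is_svd Q A ?s B"
    by (simp add: is_ordered_svd_def)
  obtain v where "orthonormal_upto CARD('k) v"
    and norm_x: "\<And>x. (norm x)\<^sup>2 = (\<Sum>j<CARD('k). (v j \<bullet> x)\<^sup>2)"
    and norm_Qx: "\<And>x. (norm (Q *v x))\<^sup>2 = (\<Sum>j<length ?s. (?s ! j)\<^sup>2 * (v j \<bullet> x)\<^sup>2)"
    using is_svd_norms[OF svd] by blast
  have le_max: "?s ! j \<le> sigma_max Q" if "j < length ?s" for j
    unfolding sigma_max_def using that by simp
  have "0 \<le> sigma_max Q"
    using le_max[of 0] is_svd_nonneg[OF svd, of 0] is_svd_length(2)[OF svd] by force
  have "(norm (Q *v x))\<^sup>2 \<le> (\<Sum>j<length ?s. (sigma_max Q)\<^sup>2 * (v j \<bullet> x)\<^sup>2)"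
    unfolding norm_Qx
    by (intro sum_mono mult_right_mono power_mono) (auto simp: le_max is_svd_nonneg[OF svd])
  also have "\<dots> \<le> (\<Sum>j<CARD('k). (sigma_max Q)\<^sup>2 * (v j \<bullet> x)\<^sup>2)"
    using is_svd_length(1)[OF svd] by (intro sum_mono2) auto
  also have "\<dots> = (sigma_max Q * norm x)\<^sup>2"
    by (simp add: norm_x power_mult_distrib flip: sum_distrib_left)
  finally show ?thesis
    by (rule power2_le_imp_le) (simp add: \<open>0 \<le> sigma_max Q\<close>)
qed

section \<open>Monotonicity of the support along the iteration\<close>

lemma hard_threshold_count:
  assumes "is_hard_threshold \<theta> Q R" and "0 \<le> \<theta>"
  obtains A s B where "is_svd Q A s B"
    and "card (supp (singular_values R)) = card {j. j < length s \<and> \<theta> < s ! j}"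
proof -
  obtain A s B where svd: "is_svd Q A s B"
    and R: "R = A ** rect_diag (map (\<lambda>x. if \<bar>x\<bar> \<le> \<theta> then 0 else x) s) ** transpose B"
    using assms(1) unfolding is_hard_threshold_def by blast
  let ?s' = "map (\<lambda>x. if \<bar>x\<bar> \<le> \<theta> then 0 else x) s"
  have "is_svd R A ?s' B"
    using svd R by (auto simp: is_svd_def)
  then have "card (supp (singular_values R)) = card (supp ?s')"
    by (rule card_supp_svd)
  moreover have "supp ?s' = {j. j < length s \<and> \<theta> < s ! j}"
  proof -
    have "?s' ! j \<noteq> 0 \<longleftrightarrow> \<theta> < s ! j" if "j < length s" for j
      using is_svd_nonneg[OF svd that] \<open>0 \<le> \<theta>\<close> that by auto
    then show ?thesis
      unfolding supp_def length_map by blast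
  qed
  ultimately show ?thesis
    using that svd by simp
qed

lemma support_projection_kernel:
  fixes T P :: "real ^ 'k ^ 'n"
  assumes "is_support_projection I T P" and "finite I"
  obtains N where "subspace N" and "\<And>x. x \<in> N \<Longrightarrow> P *v x = 0" and "CARD('k) \<le> card I + dim N"
proof -
  obtain A s B where svd: "is_ordered_svd T A s B"
    and P: "P = A ** rect_diag (map (\<lambda>i. if i \<in> I then s ! i else 0) [0..<length s]) ** transpose B"
    using assms(1) unfolding is_support_projection_def by blast
  let ?s' = "map (\<lambda>i. if i \<in> I then s ! i else 0) [0..<length s]"
  have svd': "is_svd P A ?s' B"
    using svd P by (auto simp: is_ordered_svd_def is_svd_def)
  obtain N where N: "subspace N" "\<And>x. x \<in> N \<Longrightarrow> norm (P *v x) \<le> 0 * norm x"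
    "card {j. j < length ?s' \<and> 0 < ?s' ! j} + dim N = CARD('k)"
    using svd_count_attained[OF svd' order_refl] by blast
  have "card {j. j < length ?s' \<and> 0 < ?s' ! j} \<le> card I"
    using \<open>finite I\<close> by (intro card_mono) (auto split: if_splits)
  with N show ?thesis
    by (intro that[of N]) auto
qed

text \<open>
  One iteration cannot enlarge the support. On the kernel of \<open>P\<close>, which has codimension at most
  \<open>card I\<close>, the matrix \<open>P - s *\<^sub>R D\<close> acts as \<open>- s *\<^sub>R D\<close> and hence stretches by at most \<open>\<theta>\<close>. By
  \<open>svd_count_bound\<close>, at most \<open>card I\<close> of its singular values exceed \<open>\<theta>\<close> and survive
  the thresholding.
\<close>

lemma support_step:
  fixes T P D R :: "real ^ 'k ^ 'n"
  assumes "finite I" and proj: "is_support_projection I T P"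
    and thr: "is_hard_threshold \<theta> (P - s *\<^sub>R D) R"
    and D: "s * sigma_max D \<le> \<theta>" and "0 \<le> s" and "0 \<le> \<theta>"
  shows "card (supp (singular_values R)) \<le> card I"
proof -
  obtain N where N: "subspace N" "\<And>x. x \<in> N \<Longrightarrow> P *v x = 0" "CARD('k) \<le> card I + dim N"
    using support_projection_kernel[OF proj \<open>finite I\<close>] by blast
  obtain A q B where q: "is_svd (P - s *\<^sub>R D) A q B"
    "card (supp (singular_values R)) = card {j. j < length q \<and> \<theta> < q ! j}"
    using hard_threshold_count[OF thr \<open>0 \<le> \<theta>\<close>] by blast
  have "norm ((P - s *\<^sub>R D) *v x) \<le> \<theta> * norm x" if "x \<in> N" for x
  proof -
    have "norm ((P - s *\<^sub>R D) *v x) = s * norm (D *v x)"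
      using N(2)[OF that] \<open>0 \<le> s\<close>
      by (simp add: matrix_vector_mult_diff_rdistrib flip: scaleR_matrix_vector_assoc)
    also have "\<dots> \<le> s * (sigma_max D * norm x)"
      using \<open>0 \<le> s\<close> by (intro mult_left_mono norm_le_sigma_max)
    also have "\<dots> \<le> \<theta> * norm x"
      using mult_right_mono[OF D norm_ge_zero, of x] by (simp add: mult.assoc)
    finally show ?thesis .
  qed
  from svd_count_bound[OF q(1) \<open>0 \<le> \<theta>\<close> N(1) this] N(3) q(2) show ?thesis
    by linarith
qed

theorem lemma2p9:
  fixes g :: "real ^ 'k ^ 'n \<Rightarrow> real"
    and dg :: "real ^ 'k ^ 'n \<Rightarrow> real ^ 'k ^ 'n"
    and G L lam s :: real
    and \<alpha> :: "nat \<Rightarrow> real"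
    and X Z U V :: "nat \<Rightarrow> real ^ 'k ^ 'n"
    and t :: nat
  assumes "G > 0" and "L > 0"
    and "convex_on UNIV g"
    and "\<And>Y. GDERIV g Y :> dg Y"
    and "\<And>Y. sigma_max (dg Y) \<le> G"
    and "\<And>Y1 Y2. norm (dg Y1 - dg Y2) \<le> L * norm (Y1 - Y2)"
    and "lam > 0" and "s > 0" and "s \<le> min (2 * lam / G\<^sup>2) (1 / L)"
    and "apg_support_run g dg lam s \<alpha> X Z U V"
    and "t \<ge> 1"
  shows "supp (singular_values (Z (t + 1))) \<subseteq> supp (singular_values (Z t)) \<and>
         supp (singular_values (X (t + 1))) \<subseteq> supp (singular_values (X t))"
proof -
  define r where "r = (\<lambda>Q :: real ^ 'k ^ 'n. card (supp (singular_values Q)))"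
  note run = \<open>apg_support_run g dg lam s \<alpha> X Z U V\<close>[unfolded apg_support_run_def]
  have step_bound: "s * sigma_max (dg Y) \<le> sqrt (2 * lam * s)" for Y
  proof -
    have "s * G\<^sup>2 \<le> 2 * lam"
      using assms(9) \<open>G > 0\<close> by (simp add: field_simps)
    then have "(s * G)\<^sup>2 \<le> 2 * lam * s"
      using mult_left_mono[of "s * G\<^sup>2" "2 * lam" s] \<open>s > 0\<close>
      by (simp add: power2_eq_square ac_simps)
    then have "s * G \<le> sqrt (2 * lam * s)"
      by (rule real_le_rsqrt)
    then show ?thesis
      using mult_left_mono[OF assms(5)[of Y], of s] \<open>s > 0\<close> by linarith
  qed
  have Z_step: "r (Z (i + 1)) \<le> r (Z i)" if "i \<ge> 1" for i
  proof -
    have "is_support_projection (supp (singular_values (Z i))) (U i) (V i)"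
      and "is_hard_threshold (sqrt (2 * lam * s)) (V i - s *\<^sub>R dg (V i)) (Z (i + 1))"
      using run that by blast+
    then show ?thesis
      unfolding r_def
      by (rule support_step[rotated])
        (use step_bound \<open>s > 0\<close> \<open>lam > 0\<close> in \<open>auto simp: supp_def\<close>)
  qed
  \<comment> \<open>\<open>X i\<close> is an earlier or the current iterate \<open>Z j\<close>, so it has at least the support of \<open>Z i\<close>;
    this is what makes replacing \<open>X i\<close> by \<open>Z (i + 1)\<close> harmless.\<close>
  have X_cases: "X (i + 1) = Z (i + 1) \<or> X (i + 1) = X i" if "i \<ge> 1" for i
    using run that by presburger
  have Z_le_X: "r (Z i) \<le> r (X i)" if "i \<ge> 1" for i
    using that
  proof (induction i rule: dec_induct)
    case base
    then show ?case using run by simp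
  next
    case (step i)
    then show ?case
      using Z_step[of i] X_cases[of i] by auto
  qed
  have subset_iff: "supp (singular_values Q) \<subseteq> supp (singular_values R) \<longleftrightarrow> r Q \<le> r R"
    for Q R :: "real ^ 'k ^ 'n"
    unfolding r_def by (metis supp_singular_values lessThan_subset_iff)
  have "r (X (t + 1)) \<le> r (X t)"
    using X_cases[OF \<open>t \<ge> 1\<close>] Z_step[OF \<open>t \<ge> 1\<close>] Z_le_X[OF \<open>t \<ge> 1\<close>] by auto
  then show ?thesis
    using Z_step[OF \<open>t \<ge> 1\<close>] by (simp only: subset_iff simp_thms)
qed

end
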